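(* Let $b\ge1$ be an integer, $q\in[0,1)$, $h$ a permutation of $\{1,\dots,b\}$ with $h(h(i))=i$ for all $i$, $\{p_k\}_{k\ge0}$ a probability distribution with mean $E(Z)=\sum_k kp_k$, and $H_1,\dots,H_b$ mutually disjoint sets with $\bigcup_i H_i=\{0,1,2,\dots\}$ and $\sum_{k\in H_i}kp_k=E(Z)/b$ for all $i$. Let $g_i(x)=\sum_{k\in H_i}\frac{kp_kx^{k-1}}{E(Z)}$ for $i=1,\dots,b$. For $\phi\in(0,1)$ define $\boldsymbol f=(f_1,\dots,f_b):[0,1]^b\to[0,1]^b$ by $$f_i(\boldsymbol\alpha)=1-\phi+\phi\Big((bq+1-q)\,g_{h(i)}(\alpha_{h(i)})+(1-q)\sum_{j=1,\,j\neq h(i)}^b g_j(\alpha_j)\Big),$$ and consider the fixed point equation $\boldsymbol\alpha=\boldsymbol f(\boldsymbol\alpha)$, of which $\boldsymbol1=(1,\dots,1)$ is always a solution. Let $\phi\lambda_1,\dots,\phi\lambda_b$ with $|\lambda_1|\ge\dots\ge|\lambda_b|$ be the eigenvalues of the Jacobian matrix $\boldsymbol J(\boldsymbol1)$ of $\boldsymbol f$ at $\boldsymbol1$, and let $\phi^\star=1/\lambda_1$. The solution of $\boldsymbol\alpha=\boldsymbol f(\boldsymbol\alpha)$ can be in one of two cases. 1. If $0<\phi<\phi^\star$, the point $\boldsymbol1$ is an attracting fixed point. In addition, it is the only fixed point in $[0,1]^b$. 2. If $\phi^\star<\phi<1$, the point $\boldsymbol1$ is either a repelling fixed point or a saddle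 point of the function $\boldsymbol f$. There exists another fixed point in $[0,1)^b$. This additional fixed point is an attracting fixed point.
   Context: The Jacobian matrix of $\boldsymbol f$ at $\boldsymbol a\in[0,1]^b$ is $\boldsymbol J(\boldsymbol a)=\big(\partial f_i/\partial x_j(\boldsymbol a)\big)_{i,j}=\phi\,(bq\boldsymbol H+(1-q)\boldsymbol 1_{b\times b})\,\mathrm{diag}(g_1'(a_1),\dots,g_b'(a_b))$, where $\boldsymbol 1_{b\times b}$ is the $b\times b$ all-ones matrix and $\boldsymbol H$ is the permutation matrix whose $(i,j)$ entry is $1$ if $j=h(i)$ and $0$ otherwise. It is taken as standing that, for all $j$, $g_j'$ is strictly increasing and $g_j'(1)>0$, so that $\boldsymbol J(\boldsymbol1)$ is a positive matrix; by the Perron-Frobenius theorem $\phi\lambda_1$ is then real, positive and strictly larger than $\phi\lambda_2$ in absolute value. Terminology, for the iteration $\boldsymbol x_{n+1}=\boldsymbol f(\boldsymbol x_n)$ linearized at a fixed point: the fixed point is attracting if the dominant eigenvalue of the Jacobian matrix there is less than one in absolute value, repelling if all eigenvalues are greater than one in absolute value, and a saddle point if some eigenvalues are greater than one and some are less than one in absolute value. (Interpretation: $\phi$ is the probability that a node stays in the network in node percolation on the generalized configuration model, and $\alpha_i$ is the probability that along an edge with one end attached to a stub in block $i$ one cannot reach a giant component.)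
   Formalization: In case 2 a third possibility for the point 1 is added: some eigenvalue of J(1) has modulus above 1, some has modulus exactly 1, none is below 1; neither "repelling" nor "saddle" covers it, and it occurs, e.g. b=2, h=id, q=1/2, 1<λ_2<λ_1, φ=1/λ_2. *)

theory Defs
  imports
    "HOL-Analysis.Derivative"
    "HOL-Analysis.Infinite_Sum"
    "HOL-Library.Disjoint_Sets"
    "HOL-Combinatorics.Permutations"
    "Jordan_Normal_Form.Spectral_Radius"
begin

text \<open>
  Blocks are numbered \<open>0, \<dots>, b - 1\<close> instead of \<open>1, \<dots>, b\<close>. Points of \<open>\<real>\<^sup>b\<close> are vectors in
  \<^term>\<open>carrier_vec b\<close>.
\<close>

definition mean :: "(nat \<Rightarrow> real) \<Rightarrow> real" where
  "mean p = (\<Sum>\<^sub>\<infinity>k. real k * p k)"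

text \<open>The term for \<open>k = 0\<close> vanishes because of the factor \<open>k\<close>; \<open>0 ^ 0 = 1\<close> as usual for \<open>k = 1\<close>.\<close>

definition block_gf :: "(nat \<Rightarrow> real) \<Rightarrow> nat set \<Rightarrow> real \<Rightarrow> real" where
  "block_gf p S x = (\<Sum>\<^sub>\<infinity>k\<in>S. real k * p k * x ^ (k - 1) / mean p)"

definition percolation_map ::
  "nat \<Rightarrow> real \<Rightarrow> (nat \<Rightarrow> nat) \<Rightarrow> (nat \<Rightarrow> real \<Rightarrow> real) \<Rightarrow> real \<Rightarrow> real vec \<Rightarrow> real vec" where
  "percolation_map b q h g \<phi> \<alpha> = vec b (\<lambda>i. 1 - \<phi> + \<phi> *
     ((real b * q + 1 - q) * g (h i) (\<alpha> $ h i) + (1 - q) * (\<Sum>j\<in>{..<b} - {h i}. g j (\<alpha> $ j))))"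

definition ones :: "nat \<Rightarrow> real vec" where
  "ones b = vec b (\<lambda>_. 1)"

definition unit_cube :: "nat \<Rightarrow> real vec set" where
  "unit_cube b = {\<alpha> \<in> carrier_vec b. \<forall>i<b. 0 \<le> \<alpha> $ i \<and> \<alpha> $ i \<le> 1}"

definition half_open_cube :: "nat \<Rightarrow> real vec set" where
  "half_open_cube b = {\<alpha> \<in> carrier_vec b. \<forall>i<b. 0 \<le> \<alpha> $ i \<and> \<alpha> $ i < 1}"

text \<open>
  The maps of interest are defined on the unit cube only (the power series may diverge outside),
  so partial derivatives are taken within \<open>[0, 1]\<close>, hence one-sided on the boundary of the cube.
\<close>

definition jacobian_mat :: "(real vec \<Rightarrow> real vec) \<Rightarrow> real vec \<Rightarrow> real mat" where
  "jacobian_mat f a = (let b = dim_vec a in mat b b (\<lambda>(i, j).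
     vector_derivative (\<lambda>t. f (vec b (\<lambda>k. if k = j then t else a $ k)) $ i)
       (at (a $ j) within {0..1})))"

text \<open>Eigenvalues are taken over the complex numbers.\<close>

abbreviation cjacobian :: "(real vec \<Rightarrow> real vec) \<Rightarrow> real vec \<Rightarrow> complex mat" where
  "cjacobian f a \<equiv> map_mat complex_of_real (jacobian_mat f a)"

definition attracting_fixed_point :: "(real vec \<Rightarrow> real vec) \<Rightarrow> real vec \<Rightarrow> bool" where
  "attracting_fixed_point f a \<longleftrightarrow> f a = a \<and> spectral_radius (cjacobian f a) < 1"

definition repelling_fixed_point :: "(real vec \<Rightarrow> real vec) \<Rightarrow> real vec \<Rightarrow> bool" where
  "repelling_fixed_point f a \<longleftrightarrow> f a = a \<and> (\<forall>k. eigenvalue (cjacobian f a) k \<longrightarrow> 1 < cmod k)"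

definition saddle_point :: "(real vec \<Rightarrow> real vec) \<Rightarrow> real vec \<Rightarrow> bool" where
  "saddle_point f a \<longleftrightarrow> f a = a \<and>
     (\<exists>k. eigenvalue (cjacobian f a) k \<and> 1 < cmod k) \<and>
     (\<exists>k. eigenvalue (cjacobian f a) k \<and> cmod k < 1)"

text \<open>
  The terms attracting, repelling and saddle point do not cover a fixed point with an eigenvalue
  outside the unit circle, another one exactly on it, and none inside. Such points occur: if \<open>b = 2\<close>,
  \<open>h\<close> is the identity and \<open>1 < \<bar>\<lambda>\<^sub>2\<bar> < \<lambda>\<^sub>1\<close>, then \<open>\<one> = (1, 1)\<close> is of this kind
  for \<open>\<phi> = 1 / \<bar>\<lambda>\<^sub>2\<bar>\<close>.
\<close>

definition borderline_repelling_fixed_point :: "(real vec \<Rightarrow> real vec) \<Rightarrow> real vec \<Rightarrow> bool" where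
  "borderline_repelling_fixed_point f a \<longleftrightarrow> f a = a \<and>
     (\<exists>k. eigenvalue (cjacobian f a) k \<and> 1 < cmod k) \<and>
     (\<exists>k. eigenvalue (cjacobian f a) k \<and> cmod k = 1) \<and>
     (\<forall>k. eigenvalue (cjacobian f a) k \<longrightarrow> 1 \<le> cmod k)"

end

theory Submission
  imports Defs
begin

text \<open>
  With \<open>A\<^sub>i\<^sub>j > 0\<close> denoting \<open>\<phi>\<close> times the coupling coefficients, a fixed point \<open>\<alpha>\<close> satisfies
  \<open>1 - \<alpha>\<^sub>i = \<Sum>\<^sub>j A\<^sub>i\<^sub>j (g\<^sub>j(1) - g\<^sub>j(\<alpha>\<^sub>j))\<close>. Put \<open>x = \<one> - \<alpha>\<close>. By strict convexity of the \<open>g\<^sub>j\<close>, the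
  right-hand side lies between \<open>J(\<alpha>) x\<close> and \<open>J(\<one>) x\<close>, strictly where \<open>x\<close> does not vanish. So a
  fixed point other than \<open>\<one>\<close> gives \<open>x < J(\<one>) x\<close>, which forces the spectral radius of \<open>J(\<one>)\<close>
  above \<open>1\<close>; and if \<open>\<alpha> < \<one>\<close> then \<open>J(\<alpha>) x < x\<close> with \<open>x\<close> positive, so \<open>\<alpha>\<close> is attracting.

  If the spectral radius of \<open>J(\<one>)\<close> exceeds \<open>1\<close>, there is a positive \<open>w\<close> with \<open>w < J(\<one>) w\<close>, so
  \<open>y = \<one> - \<epsilon> w\<close> satisfies \<open>f y \<le> y\<close> for small \<open>\<epsilon>\<close>, and monotonicity of \<open>f\<close> yields a fixed point
  below \<open>y\<close>. The peripheral part of Perron's theorem shows that \<open>\<lambda>\<^sub>1\<close> is positive, which turns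
  conditions on \<open>\<phi>\<close> and \<open>\<phi>\<^sup>\<star>\<close> into conditions on the spectral radius.
\<close>

section \<open>Spectral radius of nonnegative matrices\<close>

abbreviation cmat :: "real mat \<Rightarrow> complex mat" where
  "cmat \<equiv> map_mat complex_of_real"

text \<open>Eigenvectors become coordinate functions, so that the estimates below can work with
  finite sums row by row.\<close>

lemma eigenvalue_cmat_iff:
  assumes A: "A \<in> carrier_mat n n"
  shows "eigenvalue (cmat A) k \<longleftrightarrow>
    (\<exists>v. (\<exists>i<n. v i \<noteq> 0) \<and> (\<forall>i<n. (\<Sum>j<n. of_real (A $$ (i, j)) * v j) = k * v i))"
proof
  assume "eigenvalue (cmat A) k"
  then obtain v where v: "v \<in> carrier_vec n" "v \<noteq> 0\<^sub>v n" "cmat A *\<^sub>v v = k \<cdot>\<^sub>v v"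
    using A unfolding eigenvalue_def eigenvector_def by auto
  have "\<exists>i<n. v $ i \<noteq> 0"
  proof (rule ccontr)
    assume "\<not> ?thesis"
    then have "v = 0\<^sub>v n" using v(1) by (intro eq_vecI) auto
    with v(2) show False by contradiction
  qed
  moreover have "(\<Sum>j<n. of_real (A $$ (i, j)) * v $ j) = k * v $ i" if "i < n" for i
    using arg_cong[OF v(3), of "\<lambda>w. w $ i"] that A v(1)
    by (simp add: scalar_prod_def atLeast0LessThan)
  ultimately show "\<exists>v. (\<exists>i<n. v i \<noteq> 0) \<and> (\<forall>i<n. (\<Sum>j<n. of_real (A $$ (i, j)) * v j) = k * v i)"
    by (intro exI[of _ "\<lambda>i. v $ i"]) blast
next
  assume "\<exists>v. (\<exists>i<n. v i \<noteq> 0) \<and> (\<forall>i<n. (\<Sum>j<n. of_real (A $$ (i, j)) * v j) = k * v i)"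
  then obtain v i where v: "i < n" "v i \<noteq> 0"
    "\<And>i. i < n \<Longrightarrow> (\<Sum>j<n. of_real (A $$ (i, j)) * v j) = k * v i" by blast
  have "vec n v \<noteq> 0\<^sub>v n"
  proof
    assume "vec n v = 0\<^sub>v n"
    then have "vec n v $ i = 0\<^sub>v n $ i" by simp
    with v(1,2) show False by simp
  qed
  moreover have "cmat A *\<^sub>v vec n v = k \<cdot>\<^sub>v vec n v"
    using A v(3) by (intro eq_vecI) (auto simp: scalar_prod_def atLeast0LessThan)
  ultimately show "eigenvalue (cmat A) k"
    using A unfolding eigenvalue_def eigenvector_def by (intro exI[of _ "vec n v"]) auto
qed

lemma eigenvalue_spectral_radius_le:
  assumes "A \<in> carrier_mat n n" "eigenvalue A k"
  shows "cmod k \<le> spectral_radius A"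
  using assms eigenvalue_imp_nonzero_dim[OF assms] spectral_radius_mem_max(2)[OF assms(1)]
  by (auto simp: spectrum_def)

lemma ex_eigenvalue_spectral_radius:
  assumes "A \<in> carrier_mat n n" "0 < n"
  obtains k where "eigenvalue A k" "cmod k = spectral_radius A"
  using spectral_radius_mem_max(1)[OF assms] by (auto simp: spectrum_def)

text \<open>Weighted maximum norm: in a row where \<open>cmod (v i) / x i\<close> is maximal, the
  triangle inequality bounds an eigenvalue of largest modulus by the ratio of \<open>A x\<close> to
  \<open>x\<close>, which is below \<open>c\<close>.\<close>

lemma spectral_radius_less_of_contraction:
  assumes A: "A \<in> carrier_mat n n" and n: "0 < n"
    and nonneg: "\<And>i j. i < n \<Longrightarrow> j < n \<Longrightarrow> 0 \<le> A $$ (i, j)"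
    and x: "\<And>i. i < n \<Longrightarrow> 0 < x i"
    and less: "\<And>i. i < n \<Longrightarrow> (\<Sum>j<n. A $$ (i, j) * x j) < c * x i"
  shows "spectral_radius (cmat A) < c"
proof -
  obtain k where k: "eigenvalue (cmat A) k" and rho: "cmod k = spectral_radius (cmat A)"
    using ex_eigenvalue_spectral_radius[of "cmat A" n] A n by auto
  obtain v l where l: "l < n" "v l \<noteq> 0"
    and v: "\<And>i. i < n \<Longrightarrow> (\<Sum>j<n. of_real (A $$ (i, j)) * v j) = k * v i"
    using k unfolding eigenvalue_cmat_iff[OF A] by blast
  define t where "t = Max ((\<lambda>i. cmod (v i) / x i) ` {..<n})"
  have t: "cmod (v i) / x i \<le> t" if "i < n" for i
    unfolding t_def using that by (intro Max_ge) auto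
  have "t \<in> (\<lambda>i. cmod (v i) / x i) ` {..<n}"
    unfolding t_def using n by (intro Max_in) auto
  then obtain m where m: "m < n" "t = cmod (v m) / x m" by auto
  have "0 < cmod (v l) / x l" using l x by simp
  with t[OF l(1)] have t0: "0 < t" by linarith
  have bound: "cmod (v i) \<le> t * x i" if "i < n" for i
    using t[OF that] x[OF that] by (simp add: field_simps)
  have "cmod k * (t * x m) = cmod (\<Sum>j<n. of_real (A $$ (m, j)) * v j)"
    using v[OF m(1)] m x[OF m(1)] by (simp add: norm_mult)
  also have "\<dots> \<le> (\<Sum>j<n. A $$ (m, j) * cmod (v j))"
    using nonneg[OF m(1)] by (intro sum_norm_le) (simp add: norm_mult)
  also have "\<dots> \<le> (\<Sum>j<n. A $$ (m, j) * (t * x j))"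
    using nonneg[OF m(1)] bound by (intro sum_mono mult_left_mono) auto
  also have "\<dots> = t * (\<Sum>j<n. A $$ (m, j) * x j)"
    by (simp add: sum_distrib_left mult_ac)
  also have "\<dots> < t * (c * x m)" using less[OF m(1)] t0 by simp
  finally have "cmod k * (t * x m) < c * (t * x m)" by (simp add: mult_ac)
  then show ?thesis using t0 x[OF m(1)] rho by simp
qed

section \<open>Lower bounds on the spectral radius\<close>

lemma pow_mat_nonneg:
  fixes A :: "real mat"
  assumes A: "A \<in> carrier_mat n n"
    and nonneg: "\<And>i j. i < n \<Longrightarrow> j < n \<Longrightarrow> 0 \<le> A $$ (i, j)"
  shows "i < n \<Longrightarrow> j < n \<Longrightarrow> 0 \<le> (A ^\<^sub>m k) $$ (i, j)"
proof (induction k arbitrary: i j)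
  case 0
  then show ?case using A by auto
next
  case (Suc k)
  have "A ^\<^sub>m k \<in> carrier_mat n n" using A by simp
  then show ?case using Suc A nonneg by (auto simp: scalar_prod_def intro!: sum_nonneg)
qed

text \<open>Multiplication by a nonnegative matrix preserves coordinatewise inequalities, so one
  expansion step can be iterated.\<close>

lemma pow_mat_growth:
  fixes A :: "real mat"
  assumes A: "A \<in> carrier_mat n n"
    and nonneg: "\<And>i j. i < n \<Longrightarrow> j < n \<Longrightarrow> 0 \<le> A $$ (i, j)"
    and r: "0 \<le> r" and ge: "\<And>i. i < n \<Longrightarrow> r * x i \<le> (\<Sum>j<n. A $$ (i, j) * x j)"
  shows "i < n \<Longrightarrow> r ^ k * x i \<le> (\<Sum>j<n. (A ^\<^sub>m k) $$ (i, j) * x j)"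
proof (induction k)
  case 0
  then have "(\<Sum>j<n. (A ^\<^sub>m 0) $$ (i, j) * x j) = (\<Sum>j<n. if i = j then x j else 0)"
    using A by (intro sum.cong) auto
  with 0 show ?case by simp
next
  case (Suc k)
  have P: "A ^\<^sub>m k \<in> carrier_mat n n" using A by simp
  have "r ^ Suc k * x i \<le> r * (\<Sum>l<n. (A ^\<^sub>m k) $$ (i, l) * x l)"
    using mult_left_mono[OF Suc.IH[OF Suc.prems] r] by (simp add: mult_ac)
  also have "\<dots> = (\<Sum>l<n. (A ^\<^sub>m k) $$ (i, l) * (r * x l))"
    by (simp add: sum_distrib_left mult_ac)
  also have "\<dots> \<le> (\<Sum>l<n. (A ^\<^sub>m k) $$ (i, l) * (\<Sum>j<n. A $$ (l, j) * x j))"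
    using pow_mat_nonneg[OF A nonneg] Suc.prems ge by (intro sum_mono mult_left_mono) auto
  also have "\<dots> = (\<Sum>l<n. \<Sum>j<n. (A ^\<^sub>m k) $$ (i, l) * A $$ (l, j) * x j)"
    by (simp add: sum_distrib_left mult_ac)
  also have "\<dots> = (\<Sum>j<n. \<Sum>l<n. (A ^\<^sub>m k) $$ (i, l) * A $$ (l, j) * x j)"
    by (rule sum.swap)
  also have "\<dots> = (\<Sum>j<n. (A ^\<^sub>m Suc k) $$ (i, j) * x j)"
    using P A Suc.prems by (intro sum.cong) (auto simp: scalar_prod_def atLeast0LessThan sum_distrib_right)
  finally show ?case .
qed

text \<open>Finitely many strict inequalities leave room to the right of \<open>c\<close>. The
  common factor \<open>s\<close> serves below as a geometric growth rate and as slack for a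
  linearization.\<close>

lemma ex_uniform_ratio:
  fixes x y :: "nat \<Rightarrow> real"
  assumes "0 < n" and x: "\<And>i. i < n \<Longrightarrow> 0 \<le> x i" and less: "\<And>i. i < n \<Longrightarrow> c * x i < y i"
  obtains s where "c < s" "\<And>i. i < n \<Longrightarrow> s * x i \<le> y i"
proof -
  have "\<forall>i\<in>{..<n}. eventually (\<lambda>s. s * x i \<le> y i) (at_right c)"
  proof
    fix i assume i: "i \<in> {..<n}"
    have "((\<lambda>s. s * x i) \<longlongrightarrow> c * x i) (at_right c)" by (intro tendsto_intros)
    then have "eventually (\<lambda>s. s * x i < y i) (at_right c)"
      using less i by (intro order_tendstoD(2)) auto
    then show "eventually (\<lambda>s. s * x i \<le> y i) (at_right c)" by eventually_elim simp
  qed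
  then have "eventually (\<lambda>s. \<forall>i\<in>{..<n}. s * x i \<le> y i) (at_right c)"
    by (simp add: eventually_ball_finite)
  then have "eventually (\<lambda>s. c < s \<and> (\<forall>i\<in>{..<n}. s * x i \<le> y i)) (at_right c)"
    using eventually_at_right_less by eventually_elim simp
  then obtain s where "c < s \<and> (\<forall>i\<in>{..<n}. s * x i \<le> y i)"
    using eventually_happens'[OF trivial_limit_at_right_real] by blast
  then show thesis using that by auto
qed

text \<open>Otherwise, for \<open>c < t < s\<close> with \<open>s x \<le> A x\<close>, the powers of \<open>A / t\<close> would be bounded, although
  they expand \<open>x\<close> at the rate \<open>s / t > 1\<close>.\<close>

lemma spectral_radius_greater_of_expansion:
  assumes A: "A \<in> carrier_mat n n" and n: "0 < n"
    and nonneg: "\<And>i j. i < n \<Longrightarrow> j < n \<Longrightarrow> 0 \<le> A $$ (i, j)" and c: "0 \<le> c"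
    and x: "\<And>i. i < n \<Longrightarrow> 0 \<le> x i"
    and less: "\<And>i. i < n \<Longrightarrow> c * x i < (\<Sum>j<n. A $$ (i, j) * x j)"
  shows "c < spectral_radius (cmat A)"
proof (rule ccontr)
  assume "\<not> ?thesis"
  then have rho: "spectral_radius (cmat A) \<le> c" by simp
  obtain s where s: "c < s" "\<And>i. i < n \<Longrightarrow> s * x i \<le> (\<Sum>j<n. A $$ (i, j) * x j)"
    by (rule ex_uniform_ratio[OF n x less]) (assumption | blast)+
  define t where "t = (c + s) / 2"
  have t: "c < t" "t < s" "0 < t" using s(1) c by (auto simp: t_def)
  define B where "B = (1 / t) \<cdot>\<^sub>m A"
  have B: "B \<in> carrier_mat n n" using A by (simp add: B_def)
  have Bij: "B $$ (i, j) = A $$ (i, j) / t" if "i < n" "j < n" for i j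
    using that A by (simp add: B_def)
  have Bsum: "(\<Sum>j<n. B $$ (i, j) * y j) = (\<Sum>j<n. A $$ (i, j) * y j) / t" if "i < n" for i and y :: "nat \<Rightarrow> real"
    using that by (simp add: Bij sum_divide_distrib)
  \<comment> \<open>Multiplying an eigenvalue of \<open>B\<close> by \<open>t\<close> gives one of
    \<open>A\<close>, of modulus at most \<open>c < t\<close>.\<close>
  have "spectral_radius (cmat B) < 1"
  proof -
    obtain k where k: "eigenvalue (cmat B) k" and kr: "cmod k = spectral_radius (cmat B)"
      using ex_eigenvalue_spectral_radius[of "cmat B" n] B n by auto
    obtain v l where l: "l < n" "v l \<noteq> 0"
      and v: "\<And>i. i < n \<Longrightarrow> (\<Sum>j<n. of_real (B $$ (i, j)) * v j) = k * v i"
      using k unfolding eigenvalue_cmat_iff[OF B] by blast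
    have "(\<Sum>j<n. of_real (A $$ (i, j)) * v j) = (of_real t * k) * v i" if "i < n" for i
    proof -
      have "(\<Sum>j<n. of_real (A $$ (i, j)) * v j) = of_real t * (\<Sum>j<n. of_real (B $$ (i, j)) * v j)"
        using that t(3) by (simp add: Bij sum_distrib_left)
      then show ?thesis using v[OF that] by (simp add: mult_ac)
    qed
    with l have "eigenvalue (cmat A) (of_real t * k)" unfolding eigenvalue_cmat_iff[OF A] by blast
    then have "cmod (of_real t * k) \<le> c"
      using eigenvalue_spectral_radius_le[of "cmat A" n] A rho by fastforce
    then have "t * cmod k \<le> c" using t(3) by (simp add: norm_mult)
    with t(1) have "t * cmod k < t * 1" by linarith
    then show ?thesis using kr t(3) by simp
  qed
  \<comment> \<open>The Jordan normal form bounds the powers of a matrix with spectral radius below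
    1, uniformly in the exponent.\<close>
  then obtain C where C: "\<And>k. norm_bound (cmat B ^\<^sub>m k) C"
    using spectral_radius_jnf_norm_bound_less_1_upper_triangular[of "cmat B" n] B by auto
  have bound: "\<bar>(B ^\<^sub>m k) $$ (i, j)\<bar> \<le> C" if "i < n" "j < n" for i j k
  proof -
    have P: "B ^\<^sub>m k \<in> carrier_mat n n" using B by simp
    have "cmat B ^\<^sub>m k = cmat (B ^\<^sub>m k)" using of_real_hom.mat_hom_pow[OF B] by metis
    then have "norm_bound (cmat (B ^\<^sub>m k)) C" using C[of k] by simp
    then have "cmod (cmat (B ^\<^sub>m k) $$ (i, j)) \<le> C"
      using that carrier_matD[OF P] unfolding norm_bound_def by (metis index_map_mat(2,3))
    then show ?thesis using that carrier_matD[OF P] by (metis index_map_mat(1) norm_of_real)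
  qed
  have "\<exists>i<n. x i \<noteq> 0"
  proof (rule ccontr)
    assume "\<not> ?thesis"
    with less[OF n] n show False by simp
  qed
  then obtain l where l: "l < n" "0 < x l" using x by (metis le_less)
  have r: "1 < s / t" using t by simp
  obtain k where k: "(\<Sum>j<n. C * x j) / x l < (s / t) ^ k"
    using real_arch_pow[OF r] by blast
  have "(s / t) ^ k * x l \<le> (\<Sum>j<n. (B ^\<^sub>m k) $$ (l, j) * x j)"
  proof (rule pow_mat_growth[OF B _ _ _ l(1)])
    show "0 \<le> B $$ (i, j)" if "i < n" "j < n" for i j using that t nonneg by (simp add: Bij)
    show "0 \<le> s / t" using r by simp
    show "s / t * x i \<le> (\<Sum>j<n. B $$ (i, j) * x j)" if "i < n" for i
      using divide_right_mono[OF s(2)[OF that], of t] t that by (simp add: Bsum)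
  qed
  also have "\<dots> \<le> (\<Sum>j<n. C * x j)"
    using bound[OF l(1)] x by (intro sum_mono mult_right_mono) (auto intro: order_trans[OF abs_ge_self])
  finally show False using k l(2) by (simp add: field_simps)
qed

section \<open>Peripheral eigenvalues of a positive matrix\<close>

lemma complex_eq_cmod_of_Re:
  assumes "Re z = cmod z"
  shows "z = of_real (cmod z)"
proof -
  have "(Im z)\<^sup>2 = 0" using assms cmod_power2[of z] by simp
  with assms show ?thesis by (simp add: complex_eq_iff)
qed

text \<open>Perron's argument: for an eigenvector \<open>v\<close> to \<open>k\<close>, put
  \<open>w = A |v|\<close>. The triangle inequality gives \<open>\<rho> |v| \<le> w\<close>, and
  equality must hold everywhere, since otherwise \<open>w\<close> would be expanded by more than
  \<open>\<rho>\<close>. Equality in the triangle inequality then determines the phase of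
  \<open>k\<close>.\<close>

lemma peripheral_eigenvalue_of_positive_mat:
  assumes A: "A \<in> carrier_mat n n"
    and pos: "\<And>i j. i < n \<Longrightarrow> j < n \<Longrightarrow> 0 < A $$ (i, j)"
    and k: "eigenvalue (cmat A) k" and max: "cmod k = spectral_radius (cmat A)"
  shows "0 < spectral_radius (cmat A)" "k = of_real (spectral_radius (cmat A))"
proof -
  define \<rho> where "\<rho> = spectral_radius (cmat A)"
  have n: "0 < n" using eigenvalue_imp_nonzero_dim[OF _ k] A by auto
  have nonneg: "0 \<le> A $$ (i, j)" if "i < n" "j < n" for i j
    using pos[OF that] by (rule less_imp_le)
  have \<rho>: "0 \<le> \<rho>" "cmod k = \<rho>" using max by (simp_all add: \<rho>_def flip: max)
  obtain v l where l: "l < n" "v l \<noteq> 0"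
    and v: "\<And>i. i < n \<Longrightarrow> (\<Sum>j<n. of_real (A $$ (i, j)) * v j) = k * v i"
    using k unfolding eigenvalue_cmat_iff[OF A] by blast
  define w where "w i = (\<Sum>j<n. A $$ (i, j) * cmod (v j))" for i
  have w: "0 < w i" if "i < n" for i
    unfolding w_def using l pos that nonneg by (intro sum_pos2[of _ l]) auto
  have le: "\<rho> * cmod (v i) \<le> w i" if "i < n" for i
  proof -
    have "\<rho> * cmod (v i) = cmod (\<Sum>j<n. of_real (A $$ (i, j)) * v j)"
      using v[OF that] \<rho> by (simp add: norm_mult)
    also have "\<dots> \<le> w i"
      unfolding w_def using pos[OF that] by (intro sum_norm_le) (simp add: norm_mult less_imp_le)
    finally show ?thesis .
  qed
  have eq: "w i = \<rho> * cmod (v i)" if i: "i < n" for i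
  proof (rule ccontr)
    assume ne: "w i \<noteq> \<rho> * cmod (v i)"
    with le[OF i] have lt: "\<rho> * cmod (v i) < w i" by linarith
    \<comment> \<open>A strict inequality in the single coordinate \<open>i\<close> reaches every
      row \<open>m\<close>, because \<open>A $$ (m, i)\<close> is positive.\<close>
    have "\<rho> * w m < (\<Sum>j<n. A $$ (m, j) * w j)" if m: "m < n" for m
    proof -
      have "0 < (\<Sum>j<n. A $$ (m, j) * (w j - \<rho> * cmod (v j)))"
        using i m pos[OF m i] lt nonneg le
        by (intro sum_pos2[of _ i]) (auto simp: zero_less_mult_iff zero_le_mult_iff)
      also have "\<dots> = (\<Sum>j<n. A $$ (m, j) * w j) - \<rho> * w m"
        by (simp add: w_def right_diff_distrib sum_subtractf sum_distrib_left mult_ac)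
      finally show ?thesis by simp
    qed
    then have "\<rho> < spectral_radius (cmat A)"
      using A n pos \<rho> w by (intro spectral_radius_greater_of_expansion[where x = w]) (auto intro: less_imp_le)
    then show False by (simp add: \<rho>_def)
  qed
  have v0: "v 0 \<noteq> 0" using eq[OF n] w[OF n] by auto
  show pos_rho: "0 < spectral_radius (cmat A)"
    using eq[OF n] w[OF n] \<rho> by (auto simp: \<rho>_def[symmetric] less_le)
  \<comment> \<open>\<open>u\<close> is the phase of coordinate 0 of \<open>A v\<close>.\<close>
  define u where "u = sgn (k * v 0)"
  have "k * v 0 \<noteq> 0" using v0 \<rho>(2) pos_rho by (auto simp: \<rho>_def)
  then have u: "cmod u = 1" by (simp add: u_def norm_sgn)
  then have uu: "u * cnj u = 1" by (simp add: complex_norm_square[symmetric])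
  have ukv: "k * v 0 = u * of_real (w 0)"
    using eq[OF n] \<rho>(2) norm_mult[of k "v 0"] \<open>k * v 0 \<noteq> 0\<close> pos_rho[folded \<rho>_def]
    by (simp add: u_def complex_sgn_def field_simps scaleR_conv_of_real)
  \<comment> \<open>Equality in the triangle inequality forces all entries of \<open>v\<close> to have the same phase \<open>u\<close>.\<close>
  have "(\<Sum>j<n. A $$ (0, j) * (cmod (v j) - Re (cnj u * v j))) = w 0 - Re (cnj u * (k * v 0))"
    unfolding v[OF n, symmetric] sum_distrib_left Re_sum w_def
    by (simp add: right_diff_distrib sum_subtractf algebra_simps)
  also have "cnj u * (k * v 0) = of_real (w 0)"
    using uu by (simp add: ukv mult_ac)
  finally have "(\<Sum>j<n. A $$ (0, j) * (cmod (v j) - Re (cnj u * v j))) = 0" by simp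
  moreover have "Re (cnj u * v j) \<le> cmod (v j)" for j
    using complex_Re_le_cmod[of "cnj u * v j"] u by (simp add: norm_mult)
  ultimately have "\<forall>j\<in>{..<n}. A $$ (0, j) * (cmod (v j) - Re (cnj u * v j)) = 0"
    using nonneg[OF n] by (subst (asm) sum_nonneg_eq_0_iff) auto
  \<comment> \<open>Entry 0 of \<open>v\<close> has the phase \<open>u\<close> of
    \<open>k * v 0\<close>, so \<open>k\<close> is the positive ratio of their moduli, which is
    \<open>\<rho>\<close>.\<close>
  then have "A $$ (0, 0) * (cmod (v 0) - Re (cnj u * v 0)) = 0" using n by blast
  then have "Re (cnj u * v 0) = cmod (cnj u * v 0)"
    using pos[OF n n] u by (simp add: norm_mult)
  from complex_eq_cmod_of_Re[OF this] have "cnj u * v 0 = of_real (cmod (v 0))"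
    using u by (simp add: norm_mult)
  then have "v 0 = u * of_real (cmod (v 0))"
    using uu by (metis mult.assoc mult_1)
  then have "k * v 0 = of_real \<rho> * v 0"
    using ukv eq[OF n] by (metis mult.commute mult.assoc of_real_mult)
  then show "k = of_real (spectral_radius (cmat A))" using v0 by (simp add: \<rho>_def)
qed


section \<open>Fixed points of monotone maps with convex coordinates\<close>

lemma ones_in_unit_cube: "ones n \<in> unit_cube n"
  by (simp add: ones_def unit_cube_def)

text \<open>The features of the percolation map behind the argument. A strictly increasing
  \<open>g'\<close> encodes strict convexity; derivatives are one-sided at 0 and 1, as in
  \<open>jacobian_mat\<close>. \<open>F\<close> is a parameter with a defining equation, so that the
  results apply verbatim to a given map.\<close>

locale coupled_convex_map =
  fixes n :: nat and A :: "nat \<Rightarrow> nat \<Rightarrow> real" and c :: "nat \<Rightarrow> real"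
    and g g' :: "nat \<Rightarrow> real \<Rightarrow> real" and F :: "real vec \<Rightarrow> real vec"
  assumes n: "0 < n"
    and A: "\<And>i j. i < n \<Longrightarrow> j < n \<Longrightarrow> 0 < A i j"
    and c: "\<And>i. i < n \<Longrightarrow> 0 \<le> c i"
    and g_nonneg: "\<And>j x. j < n \<Longrightarrow> x \<in> {0..1} \<Longrightarrow> 0 \<le> g j x"
    and deriv: "\<And>j x. j < n \<Longrightarrow> x \<in> {0..1} \<Longrightarrow> (g j has_real_derivative g' j x) (at x within {0..1})"
    and g'_mono: "\<And>j. j < n \<Longrightarrow> strict_mono_on {0..1} (g' j)"
    and g'_nonneg: "\<And>j x. j < n \<Longrightarrow> x \<in> {0..1} \<Longrightarrow> 0 \<le> g' j x"
    and F: "\<And>x. F x = vec n (\<lambda>i. c i + (\<Sum>j<n. A i j * g j (x $ j)))"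
    and F_ones: "F (ones n) = ones n"
begin

lemma F_dim [simp]: "dim_vec (F x) = n"
  by (simp add: F)

section \<open>Monotonicity, secants and deviations from the point of ones\<close>

lemma mean_value:
  assumes "j < n" "0 \<le> a" "a < d" "d \<le> 1"
  obtains z where "a < z" "z < d" "g j d - g j a = g' j z * (d - a)"
proof -
  have "(g j has_derivative (*) (g' j x)) (at x within {a..d})" if "a \<le> x" "x \<le> d" for x
    using deriv[of j x] assms that
    by (auto simp: has_field_derivative_def intro: has_derivative_subset)
  then have "\<exists>z\<in>{a<..<d}. g j d - g j a = g' j z * (d - a)"
    using \<open>a < d\<close> by (intro mvt_simple)
  then show thesis using that by auto
qed

lemma g_mono:
  assumes "j < n" "0 \<le> a" "a \<le> d" "d \<le> 1"
  shows "g j a \<le> g j d"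
proof (cases "a = d")
  case False
  then obtain z where z: "a < z" "z < d" "g j d - g j a = g' j z * (d - a)"
    using mean_value[of j a d] assms by (metis le_less)
  moreover have "0 \<le> g' j z" using g'_nonneg assms z by simp
  ultimately have "0 \<le> g j d - g j a" using assms by simp
  then show ?thesis by simp
qed simp

text \<open>By the mean value theorem the secant slope between \<open>x\<close> and 1 is the value
  of \<open>g' j\<close> at a point strictly between them.\<close>

lemma secant_bounds:
  assumes "j < n" "0 \<le> x" "x < 1"
  shows "g' j x * (1 - x) < g j 1 - g j x" "g j 1 - g j x < g' j 1 * (1 - x)"
proof -
  obtain z where z: "x < z" "z < 1" "g j 1 - g j x = g' j z * (1 - x)"
    using mean_value[of j x 1] assms by auto
  have "g' j x < g' j z" "g' j z < g' j 1"
    using strict_mono_onD[OF g'_mono[OF assms(1)]] assms z by simp_all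
  then show "g' j x * (1 - x) < g j 1 - g j x" "g j 1 - g j x < g' j 1 * (1 - x)"
    using z assms by simp_all
qed

lemma g'_one_pos: "j < n \<Longrightarrow> 0 < g' j 1"
  using strict_mono_onD[OF g'_mono, of j 0 1] g'_nonneg[of j 0] by simp

text \<open>Subtracting the fixed point equation at \<open>ones n\<close> eliminates the constants
  \<open>c\<close>; for a fixed point this becomes an equation for its deviation from
  \<open>ones n\<close>.\<close>

lemma one_minus_F:
  assumes "i < n"
  shows "1 - F x $ i = (\<Sum>j<n. A i j * (g j 1 - g j (x $ j)))"
proof -
  have "1 = F (ones n) $ i" using assms by (simp only: F_ones) (simp add: ones_def)
  also have "\<dots> = c i + (\<Sum>j<n. A i j * g j 1)"
    using assms by (simp add: F ones_def)
  finally show ?thesis using assms by (simp add: F right_diff_distrib sum_subtractf)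
qed

lemma F_mono:
  assumes "i < n" "x \<in> unit_cube n" "y \<in> unit_cube n" "\<And>j. j < n \<Longrightarrow> x $ j \<le> y $ j"
  shows "F x $ i \<le> F y $ i"
  using assms A g_mono
  by (auto simp: F unit_cube_def intro!: sum_mono mult_left_mono intro: less_imp_le)

lemma F_in_unit_cube:
  assumes "x \<in> unit_cube n"
  shows "F x \<in> unit_cube n"
proof -
  have "F x $ i \<le> 1" if "i < n" for i
    using F_mono[OF that assms ones_in_unit_cube] assms that
    unfolding F_ones by (simp add: ones_def unit_cube_def)
  moreover have "0 \<le> F x $ i" if "i < n" for i
    using that c A g_nonneg assms
    by (auto simp: F unit_cube_def intro!: add_nonneg_nonneg sum_nonneg mult_nonneg_nonneg intro: less_imp_le)
  ultimately show ?thesis by (auto simp: unit_cube_def F)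
qed

section \<open>The Jacobian matrix and its spectral radius at fixed points\<close>

lemma jacobian_mat_F:
  assumes "a \<in> unit_cube n"
  shows "jacobian_mat F a = mat n n (\<lambda>(i, j). A i j * g' j (a $ j))"
proof -
  have "vector_derivative (\<lambda>t. F (vec n (\<lambda>k. if k = j then t else a $ k)) $ i) (at (a $ j) within {0..1})
      = A i j * g' j (a $ j)" if ij: "i < n" "j < n" for i j
  proof -
    have aj: "a $ j \<in> {0..1}" using assms ij by (simp add: unit_cube_def)
    define C where "C = c i + (\<Sum>k\<in>{..<n} - {j}. A i k * g k (a $ k))"
    have "F (vec n (\<lambda>k. if k = j then t else a $ k)) $ i = C + A i j * g j t" for t
      using ij by (simp add: F C_def sum.remove[of "{..<n}" j])
    moreover have "((\<lambda>t. C + A i j * g j t) has_vector_derivative A i j * g' j (a $ j)) (at (a $ j) within {0..1})"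
      unfolding has_real_derivative_iff_has_vector_derivative[symmetric]
      using deriv[OF ij(2) aj] by (auto intro!: derivative_eq_intros)
    \<comment> \<open>Derivatives within a nondegenerate interval are unique, also at its
      endpoints.\<close>
    ultimately show ?thesis
      using aj by (simp add: vector_derivative_within_closed_interval)
  qed
  then show ?thesis
    using assms by (intro eq_matI) (auto simp: jacobian_mat_def Let_def unit_cube_def)
qed

lemma jacobian_mat_F_carrier: "a \<in> unit_cube n \<Longrightarrow> jacobian_mat F a \<in> carrier_mat n n"
  by (simp add: jacobian_mat_F)

lemma jacobian_mat_F_index:
  "a \<in> unit_cube n \<Longrightarrow> i < n \<Longrightarrow> j < n \<Longrightarrow> jacobian_mat F a $$ (i, j) = A i j * g' j (a $ j)"
  by (simp add: jacobian_mat_F)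

lemma jacobian_mat_F_nonneg:
  "a \<in> unit_cube n \<Longrightarrow> i < n \<Longrightarrow> j < n \<Longrightarrow> 0 \<le> jacobian_mat F a $$ (i, j)"
  using A[of i j] g'_nonneg[of j "a $ j"] by (simp add: jacobian_mat_F_index unit_cube_def)

lemma jacobian_ones_carrier: "jacobian_mat F (ones n) \<in> carrier_mat n n"
  by (rule jacobian_mat_F_carrier[OF ones_in_unit_cube])

lemma jacobian_ones_index:
  "i < n \<Longrightarrow> j < n \<Longrightarrow> jacobian_mat F (ones n) $$ (i, j) = A i j * g' j 1"
  by (simp add: jacobian_mat_F_index[OF ones_in_unit_cube]) (simp add: ones_def)

lemma jacobian_ones_pos:
  "i < n \<Longrightarrow> j < n \<Longrightarrow> 0 < jacobian_mat F (ones n) $$ (i, j)"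
  by (simp add: jacobian_ones_index A g'_one_pos)

text \<open>The expansion criterion is applied to the deviation \<open>1 - \<alpha>\<close>: secants
  ending at 1 are less steep than the tangent at 1, so the Jacobian matrix at \<open>ones n\<close>
  enlarges the deviation strictly.\<close>

lemma spectral_radius_ones_gt_one:
  assumes \<alpha>: "\<alpha> \<in> unit_cube n" "F \<alpha> = \<alpha>" "\<alpha> \<noteq> ones n"
  shows "1 < spectral_radius (cjacobian F (ones n))"
proof (rule spectral_radius_greater_of_expansion[OF jacobian_ones_carrier n])
  have cube: "0 \<le> \<alpha> $ j" "\<alpha> $ j \<le> 1" if "j < n" for j
    using \<alpha>(1) that by (simp_all add: unit_cube_def)
  have "\<exists>l<n. \<alpha> $ l < 1"
  proof (rule ccontr)
    assume "\<not> ?thesis"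
    then have "\<alpha> $ j = 1" if "j < n" for j using that cube[of j] by force
    then have "\<alpha> = ones n" using \<alpha>(1) by (intro eq_vecI) (auto simp: ones_def unit_cube_def)
    with \<alpha>(3) show False by contradiction
  qed
  then obtain l where l: "l < n" "\<alpha> $ l < 1" by blast
  show "0 \<le> 1 - \<alpha> $ i" if "i < n" for i using cube[OF that] by simp
  show "1 * (1 - \<alpha> $ i) < (\<Sum>j<n. jacobian_mat F (ones n) $$ (i, j) * (1 - \<alpha> $ j))" if i: "i < n" for i
  proof -
    \<comment> \<open>Coordinates equal to 1 give equality; one coordinate \<open>l\<close> below 1
      makes every row strict, as all couplings are positive.\<close>
    have "A i j * (g j 1 - g j (\<alpha> $ j)) \<le> A i j * (g' j 1 * (1 - \<alpha> $ j))" if "j < n" for j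
      using cube[OF that] secant_bounds(2)[OF that, of "\<alpha> $ j"] A[OF i that]
      by (cases "\<alpha> $ j = 1") auto
    moreover have "A i l * (g l 1 - g l (\<alpha> $ l)) < A i l * (g' l 1 * (1 - \<alpha> $ l))"
      using l cube[OF l(1)] secant_bounds(2)[OF l(1), of "\<alpha> $ l"] A[OF i l(1)] by simp
    ultimately have "(\<Sum>j<n. A i j * (g j 1 - g j (\<alpha> $ j))) < (\<Sum>j<n. A i j * (g' j 1 * (1 - \<alpha> $ j)))"
      using l by (intro sum_strict_mono_ex1) auto
    also have "(\<Sum>j<n. A i j * (g j 1 - g j (\<alpha> $ j))) = 1 - \<alpha> $ i"
      using one_minus_F[OF i, of \<alpha>] \<alpha>(2) by simp
    finally show ?thesis using i by (simp add: jacobian_ones_index mult.assoc)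
  qed
qed (auto intro: less_imp_le jacobian_ones_pos)

text \<open>Here the deviation \<open>1 - \<alpha>\<close> is positive and serves as weight in the
  contraction criterion: tangents at \<open>\<alpha>\<close> are flatter than the secants to 1,
  whose weighted sum returns the deviation.\<close>

lemma spectral_radius_less_one_below_ones:
  assumes \<alpha>: "\<alpha> \<in> half_open_cube n" "F \<alpha> = \<alpha>"
  shows "spectral_radius (cjacobian F \<alpha>) < 1"
proof -
  have cube: "\<alpha> \<in> unit_cube n" using \<alpha>(1) by (auto simp: half_open_cube_def unit_cube_def less_imp_le)
  have bounds: "0 \<le> \<alpha> $ j" "\<alpha> $ j < 1" if "j < n" for j
    using \<alpha>(1) that by (simp_all add: half_open_cube_def)
  show ?thesis
  proof (rule spectral_radius_less_of_contraction[OF jacobian_mat_F_carrier[OF cube] n])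
    show "0 < 1 - \<alpha> $ i" if "i < n" for i using bounds[OF that] by simp
    show "(\<Sum>j<n. jacobian_mat F \<alpha> $$ (i, j) * (1 - \<alpha> $ j)) < 1 * (1 - \<alpha> $ i)" if i: "i < n" for i
    proof -
      have "(\<Sum>j<n. A i j * (g' j (\<alpha> $ j) * (1 - \<alpha> $ j))) < (\<Sum>j<n. A i j * (g j 1 - g j (\<alpha> $ j)))"
        using n A[OF i] bounds secant_bounds(1) by (intro sum_strict_mono) auto
      also have "\<dots> = 1 - \<alpha> $ i"
        using one_minus_F[OF i, of \<alpha>] \<alpha>(2) by simp
      finally show ?thesis using i by (simp add: jacobian_mat_F_index[OF cube] mult.assoc)
    qed
  qed (simp add: jacobian_mat_F_nonneg[OF cube])
qed

section \<open>A fixed point strictly below the point of ones\<close>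

text \<open>From \<open>ones n\<close>, move a short way against a positive vector \<open>w\<close>
  that the Jacobian matrix enlarges by at least a factor \<open>s > 1\<close>. The slack in
  \<open>s\<close> absorbs the linearization error.\<close>

lemma ex_point_mapped_below:
  assumes "1 < spectral_radius (cjacobian F (ones n))"
  obtains y where "y \<in> half_open_cube n" "\<And>i. i < n \<Longrightarrow> F y $ i \<le> y $ i"
proof -
  define J where "J i j = A i j * g' j 1" for i j
  have J: "0 < J i j" if "i < n" "j < n" for i j using that A g'_one_pos by (simp add: J_def)
  obtain k where k: "eigenvalue (cjacobian F (ones n)) k"
    and "cmod k = spectral_radius (cjacobian F (ones n))"
    by (rule ex_eigenvalue_spectral_radius[OF iffD2[OF map_carrier_mat jacobian_ones_carrier] n])
  with assms have k_gt: "1 < cmod k" by simp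
  obtain v l where l: "l < n" "v l \<noteq> 0"
    and v: "\<And>i. i < n \<Longrightarrow> (\<Sum>j<n. of_real (jacobian_mat F (ones n) $$ (i, j)) * v j) = k * v i"
    using k unfolding eigenvalue_cmat_iff[OF jacobian_ones_carrier] by blast
  \<comment> \<open>One application of the positive matrix turns the moduli of an eigenvector into a
    vector without zero entries; \<open>cmod k > 1\<close> then makes the expansion of
    \<open>w\<close> strict.\<close>
  define w where "w i = (\<Sum>j<n. J i j * cmod (v j))" for i
  have w: "0 < w i" if "i < n" for i
    unfolding w_def using l J[OF that] by (intro sum_pos2[of _ l]) (auto simp: zero_le_mult_iff less_imp_le)
  have le: "cmod k * cmod (v i) \<le> w i" if "i < n" for i
  proof -
    have "cmod k * cmod (v i) = cmod (\<Sum>j<n. of_real (J i j) * v j)"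
      using v[OF that] that by (simp add: norm_mult J_def jacobian_ones_index)
    also have "\<dots> \<le> w i"
      unfolding w_def using J[OF that] by (intro sum_norm_le) (simp add: norm_mult less_imp_le)
    finally show ?thesis .
  qed
  have expand: "1 * w i < (\<Sum>j<n. J i j * w j)" if i: "i < n" for i
  proof -
    have "w i < cmod k * w i" using w[OF i] k_gt by simp
    also have "\<dots> = (\<Sum>j<n. J i j * (cmod k * cmod (v j)))"
      by (simp add: w_def sum_distrib_left mult_ac)
    also have "\<dots> \<le> (\<Sum>j<n. J i j * w j)"
      using J[OF i] le by (intro sum_mono mult_left_mono) (auto simp: less_imp_le)
    finally show ?thesis by simp
  qed
  have w_nonneg: "0 \<le> w i" if "i < n" for i using w[OF that] by simp
  obtain s where s: "1 < s" and sw: "\<And>i. i < n \<Longrightarrow> s * w i \<le> (\<Sum>j<n. J i j * w j)"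
    by (rule ex_uniform_ratio[OF n w_nonneg expand]) (assumption | blast)+
  have "\<forall>j\<in>{..<n}. eventually (\<lambda>\<epsilon>. \<epsilon> * w j < 1 \<and> g' j 1 * (\<epsilon> * w j) \<le> s * (g j 1 - g j (1 - \<epsilon> * w j))) (at_right 0)"
  proof
    fix j assume "j \<in> {..<n}"
    then have j: "j < n" by simp
    have "((\<lambda>y. (g j y - g j 1) / (y - 1)) \<longlongrightarrow> g' j 1) (at 1 within {0..1})"
      using deriv[OF j, of 1] by (simp add: has_field_derivative_iff)
    \<comment> \<open>Since \<open>s > 1\<close>, difference quotients at 1 eventually exceed
      \<open>g' j 1 / s\<close>; this is evaluated at \<open>1 - \<epsilon> * w j\<close>
      below.\<close>
    moreover have "g' j 1 / s < g' j 1" using s g'_one_pos[OF j] by (simp add: field_simps)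
    ultimately have "eventually (\<lambda>y. g' j 1 / s < (g j y - g j 1) / (y - 1)) (at 1 within {0..1})"
      by (rule order_tendstoD)
    then obtain d where d: "0 < d"
      and quot: "\<And>y. y \<in> {0..1} \<Longrightarrow> y \<noteq> 1 \<Longrightarrow> dist y 1 < d \<Longrightarrow> g' j 1 / s < (g j y - g j 1) / (y - 1)"
      unfolding eventually_at by blast
    have "((\<lambda>\<epsilon>. \<epsilon> * w j) \<longlongrightarrow> 0 * w j) (at_right 0)" by (intro tendsto_intros)
    then have "eventually (\<lambda>\<epsilon>. \<epsilon> * w j < min 1 d) (at_right 0)"
      using d by (intro order_tendstoD(2)) auto
    then show "eventually (\<lambda>\<epsilon>. \<epsilon> * w j < 1 \<and> g' j 1 * (\<epsilon> * w j) \<le> s * (g j 1 - g j (1 - \<epsilon> * w j))) (at_right 0)"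
      using eventually_at_right_less[of 0]
    proof eventually_elim
      case (elim \<epsilon>)
      have pos: "0 < \<epsilon> * w j" using elim w[OF j] by simp
      have "g' j 1 / s < (g j (1 - \<epsilon> * w j) - g j 1) / ((1 - \<epsilon> * w j) - 1)"
        using elim pos by (intro quot) (auto simp: dist_real_def)
      also have "\<dots> = (g j 1 - g j (1 - \<epsilon> * w j)) / (\<epsilon> * w j)"
        by (simp add: minus_divide_left[symmetric] diff_divide_distrib)
      finally show ?case using elim pos s by (simp add: field_simps)
    qed
  qed
  then have "eventually (\<lambda>\<epsilon>. \<forall>j\<in>{..<n}. \<epsilon> * w j < 1 \<and> g' j 1 * (\<epsilon> * w j) \<le> s * (g j 1 - g j (1 - \<epsilon> * w j))) (at_right 0)"
    by (simp add: eventually_ball_finite)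
  then have "eventually (\<lambda>\<epsilon>. 0 < \<epsilon> \<and> (\<forall>j\<in>{..<n}. \<epsilon> * w j < 1 \<and> g' j 1 * (\<epsilon> * w j) \<le> s * (g j 1 - g j (1 - \<epsilon> * w j)))) (at_right 0)"
    using eventually_at_right_less by eventually_elim simp
  then obtain \<epsilon> :: real where \<epsilon>: "0 < \<epsilon>" "\<And>j. j < n \<Longrightarrow> \<epsilon> * w j < 1"
    "\<And>j. j < n \<Longrightarrow> g' j 1 * (\<epsilon> * w j) \<le> s * (g j 1 - g j (1 - \<epsilon> * w j))"
    using eventually_happens'[OF trivial_limit_at_right_real] by fastforce
  define y where "y = vec n (\<lambda>j. 1 - \<epsilon> * w j)"
  have "y \<in> half_open_cube n"
    using \<epsilon> w by (auto simp: y_def half_open_cube_def less_imp_le)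
  moreover have "F y $ i \<le> y $ i" if i: "i < n" for i
  proof -
    \<comment> \<open>The factor \<open>s\<close> gained from expanding \<open>w\<close> cancels the
      one lost to the difference quotients.\<close>
    have "s * (\<epsilon> * w i) = \<epsilon> * (s * w i)" by simp
    also have "\<dots> \<le> \<epsilon> * (\<Sum>j<n. J i j * w j)" using sw[OF i] \<epsilon>(1) by simp
    also have "\<dots> = (\<Sum>j<n. A i j * (g' j 1 * (\<epsilon> * w j)))"
      by (simp add: J_def sum_distrib_left mult_ac)
    also have "\<dots> \<le> (\<Sum>j<n. A i j * (s * (g j 1 - g j (1 - \<epsilon> * w j))))"
      using A[OF i] \<epsilon>(3) by (intro sum_mono mult_left_mono) (auto simp: less_imp_le)
    also have "\<dots> = s * (1 - F y $ i)"
      by (simp add: one_minus_F[OF i] y_def sum_distrib_left mult_ac)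
    finally have "\<epsilon> * w i \<le> 1 - F y $ i" using s by simp
    then show ?thesis using i by (simp add: y_def)
  qed
  ultimately show thesis using that by blast
qed

text \<open>Knaster--Tarski; the fixed point is the infimum of all points mapped below themselves.\<close>

lemma ex_fixed_point_le:
  assumes y: "y \<in> unit_cube n" "\<And>i. i < n \<Longrightarrow> F y $ i \<le> y $ i"
  obtains \<alpha> where "\<alpha> \<in> unit_cube n" "F \<alpha> = \<alpha>" "\<And>i. i < n \<Longrightarrow> \<alpha> $ i \<le> y $ i"
proof -
  define S where "S = {x \<in> unit_cube n. \<forall>i<n. F x $ i \<le> x $ i}"
  define \<alpha> where "\<alpha> = vec n (\<lambda>i. INF x\<in>S. x $ i)"
  \<comment> \<open>\<open>y\<close> makes \<open>S\<close> nonempty, which the infima require, and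
    keeps \<open>\<alpha>\<close> below \<open>y\<close>.\<close>
  have yS: "y \<in> S" using y by (simp add: S_def)
  have bdd: "bdd_below ((\<lambda>x. x $ i) ` S)" if "i < n" for i
    using that by (intro bdd_belowI2[of _ 0]) (simp add: S_def unit_cube_def)
  have lower: "\<alpha> $ i \<le> x $ i" if "x \<in> S" "i < n" for x i
    using that bdd by (auto simp: \<alpha>_def intro: cINF_lower)
  have greatest: "z \<le> \<alpha> $ i" if "i < n" "\<And>x. x \<in> S \<Longrightarrow> z \<le> x $ i" for z i
    using that yS by (auto simp: \<alpha>_def intro!: cINF_greatest)
  have \<alpha>_cube: "\<alpha> \<in> unit_cube n"
  proof -
    have "0 \<le> \<alpha> $ i" if "i < n" for i using that by (intro greatest) (auto simp: S_def unit_cube_def)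
    moreover have "\<alpha> $ i \<le> 1" if "i < n" for i
      using lower[OF yS that] y(1) that by (auto simp: unit_cube_def)
    ultimately show ?thesis by (simp add: unit_cube_def \<alpha>_def)
  qed
  have le: "F \<alpha> $ i \<le> \<alpha> $ i" if "i < n" for i
  proof (rule greatest[OF that])
    fix x assume x: "x \<in> S"
    then have "F \<alpha> $ i \<le> F x $ i" using lower \<alpha>_cube that by (intro F_mono) (auto simp: S_def)
    also have "\<dots> \<le> x $ i" using x that by (simp add: S_def)
    finally show "F \<alpha> $ i \<le> x $ i" .
  qed
  \<comment> \<open>By monotonicity \<open>F \<alpha>\<close> is mapped below itself as well, so it
    belongs to \<open>S\<close> and the infimum \<open>\<alpha>\<close> lies below it.\<close>
  have "F \<alpha> \<in> S"
    using F_in_unit_cube[OF \<alpha>_cube] le F_mono[OF _ F_in_unit_cube[OF \<alpha>_cube] \<alpha>_cube] by (simp add: S_def)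
  then have "F \<alpha> = \<alpha>"
    using le lower by (intro eq_vecI) (auto simp: \<alpha>_def[THEN arg_cong[where f = dim_vec]] intro: antisym)
  then show thesis using that \<alpha>_cube lower[OF yS] by blast
qed

lemma ex_attracting_fixed_point:
  assumes "1 < spectral_radius (cjacobian F (ones n))"
  shows "\<exists>\<alpha>\<in>half_open_cube n. attracting_fixed_point F \<alpha>"
proof -
  obtain y where y: "y \<in> half_open_cube n" "\<And>i. i < n \<Longrightarrow> F y $ i \<le> y $ i"
    using ex_point_mapped_below[OF assms] by blast
  then have "y \<in> unit_cube n" by (auto simp: half_open_cube_def unit_cube_def less_imp_le)
  then obtain \<alpha> where \<alpha>: "\<alpha> \<in> unit_cube n" "F \<alpha> = \<alpha>" "\<And>i. i < n \<Longrightarrow> \<alpha> $ i \<le> y $ i"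
    using ex_fixed_point_le[OF _ y(2)] by blast
  then have "\<alpha> \<in> half_open_cube n"
    using y(1) by (fastforce simp: half_open_cube_def unit_cube_def)
  with \<alpha>(2) spectral_radius_less_one_below_ones show ?thesis
    by (auto simp: attracting_fixed_point_def)
qed

end


section \<open>The percolation map\<close>

lemma block_gf_nonneg:
  assumes "\<And>k. 0 \<le> p k" "0 \<le> x"
  shows "0 \<le> block_gf p S x"
proof -
  have "0 \<le> mean p" unfolding mean_def using assms by (intro infsum_nonneg) simp
  then show ?thesis unfolding block_gf_def using assms by (intro infsum_nonneg) simp
qed

lemma block_gf_mono:
  assumes p: "\<And>k. 0 \<le> p k" and summable: "(\<lambda>k. real k * p k) summable_on UNIV"
    and "0 \<le> x" "x \<le> y" "y \<le> 1"
  shows "block_gf p S x \<le> block_gf p S y"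
proof -
  have mean: "0 \<le> mean p" unfolding mean_def using p by (intro infsum_nonneg) simp
  \<comment> \<open>The terms are dominated by those at \<open>z = 1\<close>. A divergent infinite
    sum has the default value 0, so termwise comparison of sums requires summability first.\<close>
  have summ: "(\<lambda>k. real k * p k * z ^ (k - 1) / mean p) summable_on S" if z: "0 \<le> z" "z \<le> 1" for z
  proof (rule summable_on_comparison_test)
    have "(\<lambda>k. inverse (mean p) * (real k * p k)) summable_on S"
      using summable_on_subset_banach[OF summable] by (intro summable_on_cmult_right) auto
    then show "(\<lambda>k. real k * p k / mean p) summable_on S" by (simp add: field_simps)
    show "real k * p k * z ^ (k - 1) / mean p \<le> real k * p k / mean p" for k
      using p mean z power_le_one[OF z] by (intro divide_right_mono mult_left_le) auto
    show "0 \<le> real k * p k * z ^ (k - 1) / mean p" for k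
      using p mean z by simp
  qed
  show ?thesis
    unfolding block_gf_def using assms mean
    by (intro infsum_mono summ divide_right_mono mult_left_mono power_mono) auto
qed

lemma block_gf_one: "block_gf p S 1 = (\<Sum>\<^sub>\<infinity>k\<in>S. real k * p k) / mean p"
  unfolding block_gf_def divide_inverse by (simp add: infsum_cmult_left')

text \<open>Division by zero yields 0. This exposes the degenerate case, which a positive derivative
  at 1 excludes.\<close>

lemma block_gf_mean_zero:
  assumes "mean p = 0"
  shows "block_gf p S = (\<lambda>_. 0)"
  using assms by (auto simp: block_gf_def)

text \<open>Difference quotients of a monotone function are nonnegative on either side. Supplies the
  sign of \<open>g'\<close> on the whole interval.\<close>

lemma mono_has_derivative_nonneg:
  fixes f :: "real \<Rightarrow> real"
  assumes mono: "mono_on {a..b} f" and x: "x \<in> {a..b}" "a < b"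
    and D: "(f has_real_derivative D) (at x within {a..b})"
  shows "0 \<le> D"
proof (rule tendsto_lowerbound)
  show "((\<lambda>y. (f y - f x) / (y - x)) \<longlongrightarrow> D) (at x within {a..b})"
    using D by (simp add: has_field_derivative_iff)
  have "0 \<le> (f y - f x) / (y - x)" if "y \<in> {a..b}" for y
    using mono_onD[OF mono x(1) that] mono_onD[OF mono that x(1)]
    by (cases "x \<le> y") (auto simp: divide_nonneg_nonneg divide_nonpos_nonpos)
  then show "eventually (\<lambda>y. 0 \<le> (f y - f x) / (y - x)) (at x within {a..b})"
    by (auto simp: eventually_at intro: exI[of _ 1])
  show "at x within {a..b} \<noteq> bot"
    using islimpt_Icc[OF x(2)] x(1) by (simp add: trivial_limit_within)
qed

section \<open>The percolation map as a coupled convex map\<close>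

lemma percolation_map_eq:
  assumes "h permutes {..<b}"
  shows "percolation_map b q h g \<phi> x = vec b (\<lambda>i. 1 - \<phi> +
    (\<Sum>j<b. \<phi> * (if j = h i then real b * q + 1 - q else 1 - q) * g j (x $ j)))"
proof (rule eq_vecI)
  fix i assume "i < dim_vec (vec b (\<lambda>i. 1 - \<phi> +
    (\<Sum>j<b. \<phi> * (if j = h i then real b * q + 1 - q else 1 - q) * g j (x $ j))))"
  then have i: "i < b" by simp
  then have "h i < b" using permutes_in_image[OF assms, of i] by simp
  then have "(\<Sum>j<b. \<phi> * (if j = h i then real b * q + 1 - q else 1 - q) * g j (x $ j)) =
      \<phi> * (real b * q + 1 - q) * g (h i) (x $ h i) + (\<Sum>j\<in>{..<b} - {h i}. \<phi> * (1 - q) * g j (x $ j))"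
    by (simp add: sum.remove[of "{..<b}" "h i"])
  then show "percolation_map b q h g \<phi> x $ i = vec b (\<lambda>i. 1 - \<phi> +
    (\<Sum>j<b. \<phi> * (if j = h i then real b * q + 1 - q else 1 - q) * g j (x $ j))) $ i"
    using i by (simp add: percolation_map_def sum_distrib_left distrib_left mult.assoc)
qed (simp add: percolation_map_def)

text \<open>The coefficients in each row sum to \<open>(b q + 1 - q) + (b - 1) (1 - q) = b\<close>,
  which cancels the value \<open>1 / b\<close> of each \<open>g j\<close> at 1.\<close>

lemma percolation_map_ones:
  assumes "h permutes {..<b}" and g: "\<And>j. j < b \<Longrightarrow> g j 1 = 1 / real b"
  shows "percolation_map b q h g \<phi> (ones b) = ones b"
proof (rule eq_vecI)
  fix i assume "i < dim_vec (ones b)"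
  then have i: "i < b" by (simp add: ones_def)
  then have hi: "h i < b" using permutes_in_image[OF assms(1), of i] by simp
  have "(\<Sum>j\<in>{..<b} - {h i}. g j (ones b $ j)) = (\<Sum>j\<in>{..<b} - {h i}. 1 / real b)"
    by (intro sum.cong) (auto simp: ones_def g)
  also have "\<dots> = (real b - 1) / real b" using hi by (simp add: of_nat_diff)
  finally show "percolation_map b q h g \<phi> (ones b) $ i = ones b $ i"
    using i hi by (simp add: percolation_map_def g) (simp add: ones_def g field_simps)
qed (simp add: percolation_map_def ones_def)

theorem theorem3:
  fixes b :: nat and q \<phi> :: real and h :: "nat \<Rightarrow> nat" and p :: "nat \<Rightarrow> real"
    and H :: "nat \<Rightarrow> nat set" and g' :: "nat \<Rightarrow> real \<Rightarrow> real" and lam :: "nat \<Rightarrow> complex"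
  defines "g \<equiv> \<lambda>i. block_gf p (H i)"
  defines "f \<equiv> percolation_map b q h g \<phi>"
  defines "\<phi>star \<equiv> Re (1 / lam 0)"
  assumes "1 \<le> b" and "0 \<le> q" and "q < 1"
    and "h permutes {..<b}" and "\<And>i. i < b \<Longrightarrow> h (h i) = i"
    and "\<And>k. 0 \<le> p k" and "(p has_sum 1) UNIV" and "(\<lambda>k. real k * p k) summable_on UNIV"
    and "disjoint_family_on H {..<b}" and "(\<Union>i<b. H i) = UNIV"
    and "\<And>i. i < b \<Longrightarrow> (\<Sum>\<^sub>\<infinity>k\<in>H i. real k * p k) = mean p / real b"
    and "\<And>i x. i < b \<Longrightarrow> x \<in> {0..1} \<Longrightarrow> (g i has_real_derivative g' i x) (at x within {0..1})"
    and "\<And>i. i < b \<Longrightarrow> strict_mono_on {0..1} (g' i)"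
    and "\<And>i. i < b \<Longrightarrow> 0 < g' i 1"
    and "0 < \<phi>" and "\<phi> < 1"
    and "char_poly (cjacobian f (ones b)) = (\<Prod>i<b. [:- (complex_of_real \<phi> * lam i), 1:])"
    and "\<And>i j. i \<le> j \<Longrightarrow> j < b \<Longrightarrow> cmod (lam j) \<le> cmod (lam i)"
  shows "(\<phi> < \<phi>star \<longrightarrow>
           attracting_fixed_point f (ones b) \<and>
           (\<forall>\<alpha>\<in>unit_cube b. f \<alpha> = \<alpha> \<longrightarrow> \<alpha> = ones b))
       \<and> (\<phi>star < \<phi> \<longrightarrow>
           (repelling_fixed_point f (ones b) \<or> saddle_point f (ones b)
              \<or> borderline_repelling_fixed_point f (ones b)) \<and>
           (\<exists>\<alpha>\<in>half_open_cube b. attracting_fixed_point f \<alpha>))"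
proof -
  have b: "0 < b" and phi: "0 < \<phi>" "\<phi> < 1" using assms by simp_all
  have p: "0 \<le> p k" for k by fact
  have summable: "(\<lambda>k. real k * p k) summable_on UNIV" by fact
  have h: "h permutes {..<b}" by fact
  have deriv: "(g i has_real_derivative g' i x) (at x within {0..1})" if "i < b" "x \<in> {0..1}" for i x
    by (rule assms(15)[OF that])
  have g'_pos: "0 < g' i 1" if "i < b" for i by (rule assms(17)[OF that])
  \<comment> \<open>A zero mean would make \<open>g 0\<close> vanish, and uniqueness of the
    derivative would force \<open>g' 0 1 = 0\<close>.\<close>
  have mean: "mean p \<noteq> 0"
  proof
    assume "mean p = 0"
    then have "((\<lambda>_. 0) has_real_derivative g' 0 1) (at 1 within {0..1})"
      using deriv[OF b, of 1] by (simp add: g_def block_gf_mean_zero)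
    then have "vector_derivative (\<lambda>_. 0) (at (1::real) within {0..1}) = g' 0 1"
      unfolding has_real_derivative_iff_has_vector_derivative
      by (intro vector_derivative_within_closed_interval) auto
    moreover have "vector_derivative (\<lambda>_. 0) (at (1::real) within {0..1}) = (0::real)"
      by (intro vector_derivative_within_closed_interval) auto
    ultimately show False using g'_pos[OF b] by simp
  qed
  have g_one: "g i 1 = 1 / real b" if "i < b" for i
    using assms(14)[OF that] mean by (simp add: g_def block_gf_one)
  interpret coupled_convex_map b
    "\<lambda>i j. \<phi> * (if j = h i then real b * q + 1 - q else 1 - q)" "\<lambda>_. 1 - \<phi>" g g' f
  proof
    show "0 < \<phi> * (if j = h i then real b * q + 1 - q else 1 - q)" for i j
    proof -
      have "0 < real b * q + (1 - q)" using \<open>0 \<le> q\<close> \<open>q < 1\<close> by (intro add_nonneg_pos) simp_all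
      then show ?thesis using phi \<open>q < 1\<close> by simp
    qed
    show "0 \<le> g j x" if "x \<in> {0..1}" for j x
      using block_gf_nonneg[OF p] that by (simp add: g_def)
    show "0 \<le> g' j x" if "j < b" "x \<in> {0..1}" for j x
    proof (rule mono_has_derivative_nonneg[OF _ that(2) _ deriv[OF that]])
      show "mono_on {0..1} (g j)"
        by (intro mono_onI) (simp add: g_def block_gf_mono[OF p summable])
    qed simp
    show "f x = vec b (\<lambda>i. 1 - \<phi> +
        (\<Sum>j<b. \<phi> * (if j = h i then real b * q + 1 - q else 1 - q) * g j (x $ j)))" for x
      unfolding f_def by (rule percolation_map_eq[OF h])
    show "f (ones b) = ones b"
      unfolding f_def by (intro percolation_map_ones h g_one)
    show "strict_mono_on {0..1} (g' j)" if "j < b" for j by (rule assms(16)[OF that])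
  qed (use b phi deriv in auto)
  define \<rho> where "\<rho> = spectral_radius (cjacobian f (ones b))"
  have J: "cjacobian f (ones b) \<in> carrier_mat b b"
    using jacobian_ones_carrier by simp
  have eigenvalue_iff: "eigenvalue (cjacobian f (ones b)) k \<longleftrightarrow> (\<exists>i<b. k = of_real \<phi> * lam i)" for k
    unfolding eigenvalue_root_char_poly[OF J] assms(20) by (auto simp: poly_prod)
  have ev0: "eigenvalue (cjacobian f (ones b)) (of_real \<phi> * lam 0)"
    using b eigenvalue_iff by blast
  obtain k where k: "eigenvalue (cjacobian f (ones b)) k" "cmod k = \<rho>"
    unfolding \<rho>_def by (rule ex_eigenvalue_spectral_radius[OF J b])
  then obtain i where i: "i < b" "k = of_real \<phi> * lam i" using eigenvalue_iff by blast
  \<comment> \<open>The ordering of \<open>lam\<close> lets index 0 attain the spectral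
    radius.\<close>
  have "cmod k \<le> cmod (of_real \<phi> * lam 0)"
    using assms(21)[of 0 i] i phi by (simp add: norm_mult)
  then have max: "cmod (of_real \<phi> * lam 0) = \<rho>"
    using eigenvalue_spectral_radius_le[OF J ev0] k(2) by (simp add: \<rho>_def)
  note perron = peripheral_eigenvalue_of_positive_mat[OF jacobian_ones_carrier jacobian_ones_pos ev0,
      folded \<rho>_def, OF _ _ max]
  have rho: "0 < \<rho>" and "of_real \<phi> * lam 0 = of_real \<rho>" using perron by blast+
  \<comment> \<open>\<open>lam 0\<close> is the positive real \<open>\<rho> / \<phi>\<close>, so the
    real part in \<open>\<phi>star\<close> loses nothing, and comparing \<open>\<phi>\<close> with
    \<open>\<phi>star\<close> amounts to comparing \<open>\<rho>\<close> with 1.\<close>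
  then have "lam 0 = of_real (\<rho> / \<phi>)" using phi by (simp add: field_simps)
  then have star: "\<phi>star = \<phi> / \<rho>" by (simp add: \<phi>star_def flip: of_real_divide)
  show ?thesis
  proof (intro conjI impI)
    assume "\<phi> < \<phi>star"
    then have less: "\<rho> < 1" using rho phi by (simp add: star field_simps)
    then show "attracting_fixed_point f (ones b)"
      using F_ones by (simp add: attracting_fixed_point_def \<rho>_def)
    show "\<forall>\<alpha>\<in>unit_cube b. f \<alpha> = \<alpha> \<longrightarrow> \<alpha> = ones b"
      using spectral_radius_ones_gt_one less unfolding \<rho>_def by fastforce
  next
    assume "\<phi>star < \<phi>"
    then have gt: "1 < \<rho>" using rho phi by (simp add: star field_simps)
    then show "\<exists>\<alpha>\<in>half_open_cube b. attracting_fixed_point f \<alpha>"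
      using ex_attracting_fixed_point by (simp add: \<rho>_def)
    \<comment> \<open>The eigenvalue \<open>\<phi> * lam 0\<close> lies outside the unit circle. If
      some other one lies inside, the point is a saddle; otherwise it is borderline or repelling
      according to whether one lies on the circle.\<close>
    show "repelling_fixed_point f (ones b) \<or> saddle_point f (ones b)
        \<or> borderline_repelling_fixed_point f (ones b)"
      using F_ones ev0 max gt
      unfolding repelling_fixed_point_def saddle_point_def borderline_repelling_fixed_point_def
      by (metis linorder_neqE_linordered_idom not_le)
  qed
qed

end
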